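(* Assume that $\widehat F\colon H^1(\Omega)\times[H^1(\Omega)]^d\to\mathbb R$, $(\tilde\rho,u)\mapsto\widehat F(\tilde\rho,u)$, is Fréchet differentiable and that the Fréchet derivative of the reduced objective $F$ admits a primal representative $\nabla F$ with $\nabla F(\rho)\in L^\infty(\Omega)$ for all $\rho\in\mathcal A$, i.e. $\nabla F\colon\mathcal A\to L^\infty(\Omega)$. Let $\rho_k\in\mathring{\mathcal A}$ and $\alpha>0$, and let $\varphi$ be the Fermi--Dirac entropy with Bregman divergence $D_\varphi$. Then the minimization problem $$\rho_{k+1}=\operatorname*{argmin}_{\rho\in\mathcal A}\Big\{\int_\Omega\nabla F(\rho_k)\,\rho\,dx+\frac1\alpha D_\varphi(\rho,\rho_k)\Big\}$$ uniquely determines $\rho_{k+1}$. Furthermore, $\rho_{k+1}\in\mathring{\mathcal A}$ and $$\sigma^{-1}(\rho_{k+1})=\sigma^{-1}(\rho_k)-\alpha\nabla F(\rho_k)-\mu_{k+1}\quad\text{a.e. in }\Omega,$$ where $\mu_{k+1}\in\mathbb R$ solves the volume correction equation $$\int_\Omega\sigma\big(\sigma^{-1}(\rho_k)-\alpha\nabla F(\rho_k)-\mu_{k+1}\big)\,dx=\theta|\Omega|.$$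
   Context: $\Omega\subset\mathbb R^d$ ($d=2$ or $3$) is a bounded open domain with Lipschitz boundary; $|\cdot|$ is Lebesgue measure; $0\le\theta\le1$ is fixed. $L^p_\theta(\Omega)=\{\rho\in L^p(\Omega):\int_\Omega\rho\,dx=\theta|\Omega|\}$, $L^p_{[0,1]}(\Omega)=\{\rho\in L^p(\Omega):0\le\rho\le1\text{ a.e.}\}$, $\mathcal A=L^p_\theta(\Omega)\cap L^p_{[0,1]}(\Omega)$ (the same set for every $p$), $\operatorname{int}L^\infty_{[0,1]}(\Omega)=\{\rho\in L^\infty(\Omega):\operatorname{ess\,inf}\rho>0,\ \operatorname{ess\,sup}\rho<1\}$, and $\mathring{\mathcal A}=L^\infty_\theta(\Omega)\cap\operatorname{int}L^\infty_{[0,1]}(\Omega)$. Reduced objective: for a density $\rho$ with $0\le\rho\le1$, $\tilde\rho\in H^1(\Omega)$ is the weak solution of $-\epsilon^2\Delta\tilde\rho+\tilde\rho=\rho$ in $\Omega$, $\nabla\tilde\rho\cdot n=0$ on $\partial\Omega$ ($\epsilon>0$ fixed); $u\in V=\{v\in[H^1(\Omega)]^d:v|_{\Gamma_0}=0\}$ is the weak solution of $-\operatorname{div}(r(\tilde\rho)\mathsf C\varepsilon(u))=f$ in $\Omega$, $u=0$ on $\Gamma_0$, $(\mathsf C\varepsilon(u))\cdot n=0$ on $\partial\Omega\setminus\Gamma_0$, where $\Gamma_0\subset\partial\Omega$ has positive Hausdorff measure, $\varepsilon(u)=(\nabla u+\nabla u^\top)/2$, $\mathsf C$ is a symmetric positive-definite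 elasticity tensor, $f$ is a given body force (such that the weak problem is well posed, e.g. $f\in[L^2(\Omega)]^d$), and $r(t)=\underline\rho+(1-\underline\rho)t^s$ with $0<\underline\rho\ll1$, $s>1$. The reduced objective is $F(\rho)=\widehat F(\tilde\rho(\rho),u(\tilde\rho(\rho)))$. Its Fréchet derivative (with respect to $L^\infty(\Omega)$) is represented by the function $\nabla F(\rho)$: $\langle F'(\rho),q\rangle=\int_\Omega\nabla F(\rho)q\,dx$ for all $q\in L^\infty(\Omega)$. $\sigma(t)=1/(1+e^{-t})$, $\sigma^{-1}(t)=\ln(t/(1-t))$. The Fermi--Dirac entropy is $\varphi(\rho)=\int_\Omega\rho\ln\rho+(1-\rho)\ln(1-\rho)\,dx$ if $0\le\rho\le1$ a.e. (convention $0\ln0=0$) and $+\infty$ otherwise; its Bregman divergence is $D_\varphi(\rho,q)=\int_\Omega\rho\ln\frac{\rho}{q}+(1-\rho)\ln\frac{1-\rho}{1-q}\,dx$ for $\rho\in L^p_{[0,1]}(\Omega)$, $q\in\operatorname{int}L^\infty_{[0,1]}(\Omega)$. *)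

theory Defs
  imports "HOL-Analysis.Analysis" "HOL-Probability.Essential_Supremum"
begin

text \<open>Elements of the function spaces below are functions on the whole space, to be read modulo
  equality a.e. on \<open>\<Omega>\<close>; their values outside \<open>\<Omega>\<close> play no role.\<close>

section \<open>Lebesgue spaces\<close>

definition essinf :: "'a measure \<Rightarrow> ('a \<Rightarrow> ereal) \<Rightarrow> ereal" where
  "essinf M f = - esssup M (\<lambda>x. - f x)"

definition Lp :: "ennreal \<Rightarrow> 'a measure \<Rightarrow> ('a \<Rightarrow> 'b::euclidean_space) set" where
  "Lp p M = {f \<in> borel_measurable M.
     if p = \<infinity> then esssup M (\<lambda>x. ereal (norm (f x))) < \<infinity>
     else integrable M (\<lambda>x. norm (f x) powr enn2real p)}"

definition Linf_norm :: "'a measure \<Rightarrow> ('a \<Rightarrow> 'b::euclidean_space) \<Rightarrow> real" where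
  "Linf_norm M f = real_of_ereal (esssup M (\<lambda>x. ereal (norm (f x))))"

section \<open>Bounded functionals and Frechet derivatives on spaces of functions\<close>

text \<open>\<open>X\<close> is a linear space of functions and \<open>N\<close> a norm on it (a seminorm on representatives).\<close>

definition bounded_functional ::
  "('a \<Rightarrow> 'b::real_vector) set \<Rightarrow> (('a \<Rightarrow> 'b) \<Rightarrow> real) \<Rightarrow> (('a \<Rightarrow> 'b) \<Rightarrow> real) \<Rightarrow> bool" where
  "bounded_functional X N L \<longleftrightarrow>
     (\<forall>v\<in>X. \<forall>w\<in>X. \<forall>a b. L (\<lambda>x. a *\<^sub>R v x + b *\<^sub>R w x) = a * L v + b * L w) \<and>
     (\<exists>K. \<forall>v\<in>X. \<bar>L v\<bar> \<le> K * N v)"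

text \<open>\<open>L\<close> is the derivative at \<open>x\<close> of \<open>F\<close>, a functional with domain \<open>S \<subseteq> X\<close>. As \<open>N (y - x) = 0\<close> is
  not excluded, a differentiable \<open>F\<close> takes the same value at all representatives of \<open>x\<close>.\<close>

definition has_frechet_derivative_on ::
  "('a \<Rightarrow> 'b::real_vector) set \<Rightarrow> (('a \<Rightarrow> 'b) \<Rightarrow> real) \<Rightarrow> ('a \<Rightarrow> 'b) set \<Rightarrow>
   (('a \<Rightarrow> 'b) \<Rightarrow> real) \<Rightarrow> ('a \<Rightarrow> 'b) \<Rightarrow> (('a \<Rightarrow> 'b) \<Rightarrow> real) \<Rightarrow> bool" where
  "has_frechet_derivative_on X N S F x L \<longleftrightarrow>
     bounded_functional X N L \<and>
     (\<forall>e>0. \<exists>\<delta>>0. \<forall>y\<in>S. N (\<lambda>t. y t - x t) < \<delta> \<longrightarrow>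
        \<bar>F y - F x - L (\<lambda>t. y t - x t)\<bar> \<le> e * N (\<lambda>t. y t - x t))"

section \<open>Sobolev spaces\<close>

definition partial_deriv :: "'d \<Rightarrow> (real^'d \<Rightarrow> real) \<Rightarrow> real^'d \<Rightarrow> real" where
  "partial_deriv i \<phi> x = frechet_derivative \<phi> (at x) (axis i 1)"

primrec Ck :: "nat \<Rightarrow> (real^'d \<Rightarrow> real) \<Rightarrow> bool" where
  "Ck 0 \<phi> \<longleftrightarrow> continuous_on UNIV \<phi>"
| "Ck (Suc k) \<phi> \<longleftrightarrow> \<phi> differentiable_on UNIV \<and> (\<forall>i. Ck k (partial_deriv i \<phi>))"

definition test_functions :: "(real^'d) set \<Rightarrow> (real^'d \<Rightarrow> real) set" where
  "test_functions \<Omega> = {\<phi>. (\<forall>k. Ck k \<phi>) \<and> compact (closure {x. \<phi> x \<noteq> 0}) \<and>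
     closure {x. \<phi> x \<noteq> 0} \<subseteq> \<Omega>}"

definition is_weak_gradient ::
  "(real^'d) set \<Rightarrow> (real^'d \<Rightarrow> real) \<Rightarrow> (real^'d \<Rightarrow> real^'d) \<Rightarrow> bool" where
  "is_weak_gradient \<Omega> u g \<longleftrightarrow> g \<in> Lp 2 (lebesgue_on \<Omega>) \<and>
     (\<forall>\<phi>\<in>test_functions \<Omega>. \<forall>i.
        (LINT x|lebesgue_on \<Omega>. u x * partial_deriv i \<phi> x) = - (LINT x|lebesgue_on \<Omega>. g x $ i * \<phi> x))"

definition H1 :: "(real^'d) set \<Rightarrow> (real^'d \<Rightarrow> real) set" where
  "H1 \<Omega> = {u \<in> Lp 2 (lebesgue_on \<Omega>). \<exists>g. is_weak_gradient \<Omega> u g}"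

text \<open>The weak gradient is unique a.e., so the choice does not matter.\<close>

definition weak_gradient :: "(real^'d) set \<Rightarrow> (real^'d \<Rightarrow> real) \<Rightarrow> real^'d \<Rightarrow> real^'d" where
  "weak_gradient \<Omega> u = (SOME g. is_weak_gradient \<Omega> u g)"

definition H1_norm :: "(real^'d) set \<Rightarrow> (real^'d \<Rightarrow> real) \<Rightarrow> real" where
  "H1_norm \<Omega> u = sqrt ((LINT x|lebesgue_on \<Omega>. (u x)\<^sup>2) +
     (LINT x|lebesgue_on \<Omega>. (norm (weak_gradient \<Omega> u x))\<^sup>2))"

definition H1v :: "(real^'d) set \<Rightarrow> (real^'d \<Rightarrow> real^'d) set" where
  "H1v \<Omega> = {u. \<forall>i. (\<lambda>x. u x $ i) \<in> H1 \<Omega>}"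

definition H1v_norm :: "(real^'d) set \<Rightarrow> (real^'d \<Rightarrow> real^'d) \<Rightarrow> real" where
  "H1v_norm \<Omega> u = sqrt (\<Sum>i\<in>UNIV. (H1_norm \<Omega> (\<lambda>x. u x $ i))\<^sup>2)"

definition weak_jacobian :: "(real^'d) set \<Rightarrow> (real^'d \<Rightarrow> real^'d) \<Rightarrow> real^'d \<Rightarrow> real^'d^'d" where
  "weak_jacobian \<Omega> u x = (\<chi> i. weak_gradient \<Omega> (\<lambda>y. u y $ i) x)"

text \<open>The product space \<open>H\<^sup>1 \<times> [H\<^sup>1]\<^sup>d\<close>; a pair of functions is encoded as a pair-valued function.\<close>

definition H1_pair :: "(real^'d) set \<Rightarrow> (real^'d \<Rightarrow> real \<times> (real^'d)) set" where
  "H1_pair \<Omega> = {w. fst \<circ> w \<in> H1 \<Omega> \<and> snd \<circ> w \<in> H1v \<Omega>}"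

definition H1_pair_norm :: "(real^'d) set \<Rightarrow> (real^'d \<Rightarrow> real \<times> (real^'d)) \<Rightarrow> real" where
  "H1_pair_norm \<Omega> w = sqrt ((H1_norm \<Omega> (fst \<circ> w))\<^sup>2 + (H1v_norm \<Omega> (snd \<circ> w))\<^sup>2)"

section \<open>Hausdorff measure, Lipschitz domains and traces\<close>

text \<open>Normalised so that the \<open>m\<close>-dimensional measure agrees with Lebesgue measure on \<open>\<real>\<^sup>m\<close>. The outer
  measure is a metric one, hence countably additive on the Borel sets.\<close>

definition hausdorff_pre :: "nat \<Rightarrow> real \<Rightarrow> 'a::metric_space set \<Rightarrow> ennreal" where
  "hausdorff_pre m \<delta> A =
     (INF U \<in> {U :: nat \<Rightarrow> 'a set. A \<subseteq> (\<Union>n. U n) \<and> (\<forall>n. bounded (U n) \<and> diameter (U n) \<le> \<delta>)}.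
        \<Sum>n. if U n = {} then 0 else ennreal (unit_ball_vol (real m) * (diameter (U n) / 2) ^ m))"

definition hausdorff_outer :: "nat \<Rightarrow> 'a::metric_space set \<Rightarrow> ennreal" where
  "hausdorff_outer m A = (SUP \<delta>\<in>{0<..}. hausdorff_pre m \<delta> A)"

definition hausdorff_measure :: "nat \<Rightarrow> 'a::metric_space measure" where
  "hausdorff_measure m = measure_of UNIV (sets borel) (hausdorff_outer m)"

abbreviation surface_measure :: "(real^'d::finite) set \<Rightarrow> (real^'d) measure" where
  "surface_measure \<Omega> \<equiv> restrict_space (hausdorff_measure (CARD('d) - 1)) (frontier \<Omega>)"

text \<open>Near each boundary point, \<open>\<Omega>\<close> lies strictly above the graph, in direction \<open>\<nu>\<close>, of a Lipschitz
  function on the hyperplane orthogonal to \<open>\<nu>\<close>.\<close>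

definition lipschitz_boundary :: "(real^'d) set \<Rightarrow> bool" where
  "lipschitz_boundary \<Omega> \<longleftrightarrow> (\<forall>x\<in>frontier \<Omega>. \<exists>r>0. \<exists>\<nu> L. \<exists>\<gamma>::real^'d \<Rightarrow> real.
     norm \<nu> = 1 \<and> L-lipschitz_on {z. z \<bullet> \<nu> = 0} \<gamma> \<and>
     \<Omega> \<inter> ball x r = {y \<in> ball x r. \<gamma> (y - (y \<bullet> \<nu>) *\<^sub>R \<nu>) < y \<bullet> \<nu>})"

text \<open>The trace operator is the continuous extension of the restriction to the boundary from the
  functions smooth up to the boundary, which are dense in \<open>H\<^sup>1\<close> of a bounded Lipschitz domain.\<close>

definition is_trace :: "(real^'d::finite) set \<Rightarrow> (real^'d \<Rightarrow> real) \<Rightarrow> (real^'d \<Rightarrow> real) \<Rightarrow> bool" where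
  "is_trace \<Omega> v g \<longleftrightarrow> g \<in> Lp 2 (surface_measure \<Omega>) \<and>
     (\<exists>w. (\<forall>n k. Ck k (w n)) \<and>
       (\<lambda>n. H1_norm \<Omega> (\<lambda>x. w n x - v x)) \<longlonglongrightarrow> 0 \<and>
       (\<lambda>n. LINT x|surface_measure \<Omega>. (w n x - g x)\<^sup>2) \<longlonglongrightarrow> 0)"

definition trace_vanishes_on :: "(real^'d::finite) set \<Rightarrow> (real^'d) set \<Rightarrow> (real^'d \<Rightarrow> real) \<Rightarrow> bool" where
  "trace_vanishes_on \<Omega> \<Gamma>\<^sub>0 v \<longleftrightarrow>
     (\<exists>g. is_trace \<Omega> v g \<and> (AE x in surface_measure \<Omega>. x \<in> \<Gamma>\<^sub>0 \<longrightarrow> g x = 0))"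

definition V :: "(real^'d::finite) set \<Rightarrow> (real^'d) set \<Rightarrow> (real^'d \<Rightarrow> real^'d) set" where
  "V \<Omega> \<Gamma>\<^sub>0 = {v \<in> H1v \<Omega>. \<forall>i. trace_vanishes_on \<Omega> \<Gamma>\<^sub>0 (\<lambda>x. v x $ i)}"

section \<open>The reduced objective\<close>

definition filter_weak_solution ::
  "(real^'d) set \<Rightarrow> real \<Rightarrow> (real^'d \<Rightarrow> real) \<Rightarrow> (real^'d \<Rightarrow> real) \<Rightarrow> bool" where
  "filter_weak_solution \<Omega> \<epsilon> \<rho> w \<longleftrightarrow> w \<in> H1 \<Omega> \<and>
     (\<forall>v\<in>H1 \<Omega>. (LINT x|lebesgue_on \<Omega>.
          \<epsilon>\<^sup>2 * (weak_gradient \<Omega> w x \<bullet> weak_gradient \<Omega> v x) + w x * v x) =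
        (LINT x|lebesgue_on \<Omega>. \<rho> x * v x))"

definition strain :: "(real^'d) set \<Rightarrow> (real^'d \<Rightarrow> real^'d) \<Rightarrow> real^'d \<Rightarrow> real^'d^'d" where
  "strain \<Omega> u x = (1/2) *\<^sub>R (weak_jacobian \<Omega> u x + transpose (weak_jacobian \<Omega> u x))"

text \<open>Only the action on symmetric matrices matters; \<open>\<bullet>\<close> on matrices is the Frobenius product.\<close>

definition elasticity_tensor :: "(real^'d^'d \<Rightarrow> real^'d^'d) \<Rightarrow> bool" where
  "elasticity_tensor C \<longleftrightarrow> linear C \<and>
     (\<forall>A. transpose A = A \<longrightarrow> transpose (C A) = C A) \<and>
     (\<forall>A B. transpose A = A \<and> transpose B = B \<longrightarrow> C A \<bullet> B = A \<bullet> C B) \<and>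
     (\<forall>A. transpose A = A \<and> A \<noteq> 0 \<longrightarrow> C A \<bullet> A > 0)"

definition simp_law :: "real \<Rightarrow> real \<Rightarrow> real \<Rightarrow> real" where
  "simp_law \<rho>min s t = \<rho>min + (1 - \<rho>min) * t powr s"

text \<open>The body force is an arbitrary bounded functional \<open>f\<close> on \<open>V\<close>, which is what the well-posedness
  of the weak problem requires; a force field in \<open>L\<^sup>2\<close> is covered by \<open>L2_body_force\<close> below. The traction
  condition on the rest of the boundary is the natural one.\<close>

definition elasticity_weak_solution ::
  "(real^'d::finite) set \<Rightarrow> (real^'d) set \<Rightarrow> (real^'d^'d \<Rightarrow> real^'d^'d) \<Rightarrow>
   ((real^'d \<Rightarrow> real^'d) \<Rightarrow> real) \<Rightarrow> (real \<Rightarrow> real) \<Rightarrow> (real^'d \<Rightarrow> real) \<Rightarrow>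
   (real^'d \<Rightarrow> real^'d) \<Rightarrow> bool" where
  "elasticity_weak_solution \<Omega> \<Gamma>\<^sub>0 C f r w u \<longleftrightarrow> u \<in> V \<Omega> \<Gamma>\<^sub>0 \<and>
     (\<forall>v\<in>V \<Omega> \<Gamma>\<^sub>0. (LINT x|lebesgue_on \<Omega>. r (w x) * (C (strain \<Omega> u x) \<bullet> strain \<Omega> v x)) = f v)"

text \<open>Both weak problems have a solution, unique up to equality a.e.\<close>

definition filtered_density :: "(real^'d) set \<Rightarrow> real \<Rightarrow> (real^'d \<Rightarrow> real) \<Rightarrow> real^'d \<Rightarrow> real" where
  "filtered_density \<Omega> \<epsilon> \<rho> = (SOME w. filter_weak_solution \<Omega> \<epsilon> \<rho> w)"

definition displacement ::
  "(real^'d::finite) set \<Rightarrow> (real^'d) set \<Rightarrow> (real^'d^'d \<Rightarrow> real^'d^'d) \<Rightarrow>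
   ((real^'d \<Rightarrow> real^'d) \<Rightarrow> real) \<Rightarrow> (real \<Rightarrow> real) \<Rightarrow> (real^'d \<Rightarrow> real) \<Rightarrow> real^'d \<Rightarrow> real^'d" where
  "displacement \<Omega> \<Gamma>\<^sub>0 C f r w = (SOME u. elasticity_weak_solution \<Omega> \<Gamma>\<^sub>0 C f r w u)"

definition reduced_objective ::
  "(real^'d::finite) set \<Rightarrow> (real^'d) set \<Rightarrow> real \<Rightarrow> (real^'d^'d \<Rightarrow> real^'d^'d) \<Rightarrow>
   ((real^'d \<Rightarrow> real^'d) \<Rightarrow> real) \<Rightarrow> (real \<Rightarrow> real) \<Rightarrow>
   ((real^'d \<Rightarrow> real) \<Rightarrow> (real^'d \<Rightarrow> real^'d) \<Rightarrow> real) \<Rightarrow> (real^'d \<Rightarrow> real) \<Rightarrow> real" where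
  "reduced_objective \<Omega> \<Gamma>\<^sub>0 \<epsilon> C f r Fhat \<rho> =
     (let w = filtered_density \<Omega> \<epsilon> \<rho> in Fhat w (displacement \<Omega> \<Gamma>\<^sub>0 C f r w))"

section \<open>Admissible densities\<close>

definition Lp_vol :: "ennreal \<Rightarrow> real \<Rightarrow> (real^'d) set \<Rightarrow> (real^'d \<Rightarrow> real) set" where
  "Lp_vol p \<theta> \<Omega> = {\<rho> \<in> Lp p (lebesgue_on \<Omega>). (LINT x|lebesgue_on \<Omega>. \<rho> x) = \<theta> * measure lebesgue \<Omega>}"

definition Lp_box :: "ennreal \<Rightarrow> (real^'d) set \<Rightarrow> (real^'d \<Rightarrow> real) set" where
  "Lp_box p \<Omega> = {\<rho> \<in> Lp p (lebesgue_on \<Omega>). AE x in lebesgue_on \<Omega>. 0 \<le> \<rho> x \<and> \<rho> x \<le> 1}"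

definition int_Linf_box :: "(real^'d) set \<Rightarrow> (real^'d \<Rightarrow> real) set" where
  "int_Linf_box \<Omega> = {\<rho> \<in> Lp \<infinity> (lebesgue_on \<Omega>).
     essinf (lebesgue_on \<Omega>) (\<lambda>x. ereal (\<rho> x)) > 0 \<and> esssup (lebesgue_on \<Omega>) (\<lambda>x. ereal (\<rho> x)) < 1}"

definition admissible :: "ennreal \<Rightarrow> real \<Rightarrow> (real^'d) set \<Rightarrow> (real^'d \<Rightarrow> real) set" where
  "admissible p \<theta> \<Omega> = Lp_vol p \<theta> \<Omega> \<inter> Lp_box p \<Omega>"

definition admissible_interior :: "real \<Rightarrow> (real^'d) set \<Rightarrow> (real^'d \<Rightarrow> real) set" where
  "admissible_interior \<theta> \<Omega> = Lp_vol \<infinity> \<theta> \<Omega> \<inter> int_Linf_box \<Omega>"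

section \<open>Fermi--Dirac entropy\<close>

definition sigmoid :: "real \<Rightarrow> real" where
  "sigmoid t = 1 / (1 + exp (- t))"

definition logit :: "real \<Rightarrow> real" where
  "logit t = ln (t / (1 - t))"

text \<open>The convention \<open>0 ln 0 = 0\<close> holds for every value of \<open>ln 0\<close>.\<close>

definition fermi_dirac :: "(real^'d) set \<Rightarrow> (real^'d \<Rightarrow> real) \<Rightarrow> ereal" where
  "fermi_dirac \<Omega> \<rho> =
     (if AE x in lebesgue_on \<Omega>. 0 \<le> \<rho> x \<and> \<rho> x \<le> 1
      then ereal (LINT x|lebesgue_on \<Omega>. \<rho> x * ln (\<rho> x) + (1 - \<rho> x) * ln (1 - \<rho> x))
      else \<infinity>)"

definition bregman_fd :: "(real^'d) set \<Rightarrow> (real^'d \<Rightarrow> real) \<Rightarrow> (real^'d \<Rightarrow> real) \<Rightarrow> real" where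
  "bregman_fd \<Omega> \<rho> q = (LINT x|lebesgue_on \<Omega>.
     \<rho> x * ln (\<rho> x / q x) + (1 - \<rho> x) * ln ((1 - \<rho> x) / (1 - q x)))"

section \<open>Consistency of the definitions\<close>

lemma Lp2_iff: "f \<in> Lp 2 M \<longleftrightarrow> f \<in> borel_measurable M \<and> integrable M (\<lambda>x. (norm (f x))\<^sup>2)"
proof -
  have "norm (f x) powr enn2real 2 = (norm (f x))\<^sup>2" for x
    by simp
  then show ?thesis
    by (simp add: Lp_def)
qed

lemma integrable_bounded_lebesgue_on:
  fixes f :: "real^'d \<Rightarrow> real"
  assumes "bounded \<Omega>" "\<Omega> \<in> sets lebesgue" "f \<in> borel_measurable (lebesgue_on \<Omega>)"
    and "AE x in lebesgue_on \<Omega>. \<bar>f x\<bar> \<le> B"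
  shows "integrable (lebesgue_on \<Omega>) f"
proof -
  have "emeasure lebesgue \<Omega> < \<infinity>"
    using bounded_set_imp_lmeasurable[OF assms(1,2)] by (auto simp: fmeasurable_def)
  then have "emeasure (lebesgue_on \<Omega>) (space (lebesgue_on \<Omega>)) < \<infinity>"
    using assms(2) by (simp add: emeasure_restrict_space space_restrict_space)
  then have "finite_measure (lebesgue_on \<Omega>)"
    by (intro finite_measureI) auto
  then show ?thesis
    by (rule finite_measure.integrable_const_bound) (use assms in auto)
qed

lemma admissible_indep:
  assumes "bounded \<Omega>" "open \<Omega>" "1 \<le> p" "1 \<le> q"
  shows "admissible p \<theta> \<Omega> = admissible q \<theta> \<Omega>"
proof -
  have "Lp_box p \<Omega> = {\<rho> \<in> borel_measurable (lebesgue_on \<Omega>). AE x in lebesgue_on \<Omega>. 0 \<le> \<rho> x \<and> \<rho> x \<le> 1}"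
    if "1 \<le> p" for p
  proof -
    have "\<rho> \<in> Lp p (lebesgue_on \<Omega>)"
      if \<rho>: "\<rho> \<in> borel_measurable (lebesgue_on \<Omega>)" "AE x in lebesgue_on \<Omega>. 0 \<le> \<rho> x \<and> \<rho> x \<le> 1" for \<rho> :: "real^'a \<Rightarrow> real"
    proof (cases "p = \<infinity>")
      case True
      have "esssup (lebesgue_on \<Omega>) (\<lambda>x. ereal \<bar>\<rho> x\<bar>) \<le> 1"
      proof (rule esssup_I)
        show "AE x in lebesgue_on \<Omega>. ereal \<bar>\<rho> x\<bar> \<le> 1"
          using \<rho>(2) by eventually_elim simp
      qed (use \<rho>(1) in simp)
      then have "esssup (lebesgue_on \<Omega>) (\<lambda>x. ereal \<bar>\<rho> x\<bar>) < \<infinity>"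
        by (rule order.strict_trans1) simp
      then show ?thesis
        using \<rho> True by (simp add: Lp_def)
    next
      case False
      have "integrable (lebesgue_on \<Omega>) (\<lambda>x. \<bar>\<rho> x\<bar> powr enn2real p)"
        using assms(1)
      proof (rule integrable_bounded_lebesgue_on)
        show "AE x in lebesgue_on \<Omega>. \<bar>\<bar>\<rho> x\<bar> powr enn2real p\<bar> \<le> 1"
          using \<rho>(2) by eventually_elim (auto intro: powr_le1)
      qed (use \<rho> assms in auto)
      then show ?thesis
        using \<rho> False by (simp add: Lp_def)
    qed
    then show ?thesis
      unfolding Lp_box_def by (auto simp: Lp_def)
  qed
  then have "Lp_box p \<Omega> = Lp_box q \<Omega>"
    using assms by simp
  moreover have "admissible p \<theta> \<Omega> = {\<rho> \<in> Lp_box p \<Omega>. (LINT x|lebesgue_on \<Omega>. \<rho> x) = \<theta> * measure lebesgue \<Omega>}"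
    for p
    by (auto simp: admissible_def Lp_vol_def Lp_box_def)
  ultimately show ?thesis
    by simp
qed

text \<open>\<^const>\<open>bregman_fd\<close> is the Bregman divergence of \<^const>\<open>fermi_dirac\<close>, whose derivative at \<open>q\<close>
  is represented by \<open>logit q\<close>.\<close>

lemma bregman_fd_eq:
  fixes \<rho> q :: "real^'d \<Rightarrow> real"
  assumes \<Omega>: "bounded \<Omega>" "open \<Omega>" and \<rho>: "\<rho> \<in> Lp_box p \<Omega>" and q: "q \<in> int_Linf_box \<Omega>"
  shows "ereal (bregman_fd \<Omega> \<rho> q) = fermi_dirac \<Omega> \<rho> - fermi_dirac \<Omega> q -
           ereal (LINT x|lebesgue_on \<Omega>. logit (q x) * (\<rho> x - q x))"
proof -
  let ?M = "lebesgue_on \<Omega>"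
  let ?h = "\<lambda>t::real. t * ln t + (1 - t) * ln (1 - t)"
  have [measurable]: "\<rho> \<in> borel_measurable ?M" "q \<in> borel_measurable ?M"
    using \<rho> q by (auto simp: Lp_box_def int_Linf_box_def Lp_def)
  have \<rho>01: "AE x in ?M. 0 \<le> \<rho> x \<and> \<rho> x \<le> 1"
    using \<rho> by (simp add: Lp_box_def)
  obtain a where a: "0 < ereal a" "ereal a < essinf ?M (\<lambda>x. ereal (q x))"
    using q ereal_dense2 unfolding int_Linf_box_def by blast
  obtain b where b: "esssup ?M (\<lambda>x. ereal (q x)) < ereal b" "ereal b < 1"
    using q ereal_dense2 unfolding int_Linf_box_def by blast
  have "AE x in ?M. - ereal (q x) \<le> esssup ?M (\<lambda>x. - ereal (q x))"
    by (rule esssup_AE)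
  then have qa: "AE x in ?M. a \<le> q x"
  proof eventually_elim
    case (elim x)
    have "essinf ?M (\<lambda>x. ereal (q x)) \<le> ereal (q x)"
      using elim unfolding essinf_def by (metis ereal_minus_le_minus ereal_uminus_uminus)
    with a(2) have "ereal a < ereal (q x)"
      by (rule order.strict_trans2)
    then show ?case by simp
  qed
  have "AE x in ?M. ereal (q x) \<le> esssup ?M (\<lambda>x. ereal (q x))"
    by (rule esssup_AE)
  then have qb: "AE x in ?M. q x \<le> b"
  proof eventually_elim
    case (elim x)
    then have "ereal (q x) < ereal b"
      using b(1) by (rule order.strict_trans1)
    then show ?case by simp
  qed
  have ab: "0 < a" "b < 1"
    using a(1) b(2) by auto
  have tln: "\<bar>t * ln t\<bar> \<le> 1" if "0 \<le> t" "t \<le> 1" for t :: real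
  proof (cases "t = 0")
    case False
    then have t: "0 < t" using that by simp
    have "- ln t \<le> 1 / t - 1"
      using ln_le_minus_one[of "1 / t"] t by (simp add: ln_div)
    then have "t * (- ln t) \<le> t * (1 / t - 1)"
      using t by (intro mult_left_mono) auto
    also have "\<dots> \<le> 1"
      using t by (simp add: field_simps)
    finally show ?thesis
      using t that by (simp add: abs_mult)
  qed simp
  have h: "\<bar>?h t\<bar> \<le> 2" if "0 \<le> t" "t \<le> 1" for t :: real
    using tln[of t] tln[of "1 - t"] that by linarith
  have i1: "integrable ?M (\<lambda>x. ?h (\<rho> x))"
  proof (rule integrable_bounded_lebesgue_on[where B = 2])
    show "AE x in ?M. \<bar>?h (\<rho> x)\<bar> \<le> 2"
      using \<rho>01 by eventually_elim (blast intro: h)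
  qed (use \<Omega> in auto)
  have q01: "AE x in ?M. 0 < q x \<and> q x < 1"
    using qa qb by eventually_elim (use ab in auto)
  have i2: "integrable ?M (\<lambda>x. ?h (q x))"
  proof (rule integrable_bounded_lebesgue_on[where B = 2])
    show "AE x in ?M. \<bar>?h (q x)\<bar> \<le> 2"
      using q01 by eventually_elim (intro h; linarith)
  qed (use \<Omega> in auto)
  have i3: "integrable ?M (\<lambda>x. logit (q x) * (\<rho> x - q x))"
  proof (rule integrable_bounded_lebesgue_on[where B = "\<bar>ln a\<bar> + \<bar>ln (1 - b)\<bar>"])
    show "AE x in ?M. \<bar>logit (q x) * (\<rho> x - q x)\<bar> \<le> \<bar>ln a\<bar> + \<bar>ln (1 - b)\<bar>"
      using qa qb q01 \<rho>01
    proof eventually_elim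
      case (elim x)
      have "ln a \<le> ln (q x)" "ln (q x) \<le> 0" "ln (1 - b) \<le> ln (1 - q x)" "ln (1 - q x) \<le> 0"
        using elim ab by auto
      moreover have "logit (q x) = ln (q x) - ln (1 - q x)"
        using elim by (simp add: logit_def ln_div)
      ultimately have 1: "\<bar>logit (q x)\<bar> \<le> \<bar>ln a\<bar> + \<bar>ln (1 - b)\<bar>"
        by linarith
      have 2: "\<bar>\<rho> x - q x\<bar> \<le> 1"
        using elim by auto
      show ?case
        using mult_mono[OF 1 2] by (simp add: abs_mult)
    qed
    show "(\<lambda>x. logit (q x) * (\<rho> x - q x)) \<in> borel_measurable ?M"
      unfolding logit_def by measurable
  qed (use \<Omega> in auto)
  have "bregman_fd \<Omega> \<rho> q = (LINT x|?M. ?h (\<rho> x) - ?h (q x) - logit (q x) * (\<rho> x - q x))"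
    unfolding bregman_fd_def
  proof (rule integral_cong_AE)
    show "AE x in ?M. \<rho> x * ln (\<rho> x / q x) + (1 - \<rho> x) * ln ((1 - \<rho> x) / (1 - q x)) =
      ?h (\<rho> x) - ?h (q x) - logit (q x) * (\<rho> x - q x)"
      using q01 \<rho>01
    proof eventually_elim
      case (elim x)
      have 1: "\<rho> x * ln (\<rho> x / q x) = \<rho> x * ln (\<rho> x) - \<rho> x * ln (q x)"
        using elim by (cases "\<rho> x = 0") (auto simp: ln_div algebra_simps)
      have 2: "(1 - \<rho> x) * ln ((1 - \<rho> x) / (1 - q x)) =
          (1 - \<rho> x) * ln (1 - \<rho> x) - (1 - \<rho> x) * ln (1 - q x)"
        using elim by (cases "\<rho> x = 1") (auto simp: ln_div algebra_simps)
      show ?case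
        using elim unfolding 1 2 by (simp add: logit_def ln_div algebra_simps)
    qed
  qed (unfold logit_def, measurable)
  also have "\<dots> = (LINT x|?M. ?h (\<rho> x)) - (LINT x|?M. ?h (q x)) -
      (LINT x|?M. logit (q x) * (\<rho> x - q x))"
    using i1 i2 i3 by (simp add: Bochner_Integration.integral_diff)
  finally have "ereal (bregman_fd \<Omega> \<rho> q) = ereal (LINT x|?M. ?h (\<rho> x)) -
      ereal (LINT x|?M. ?h (q x)) - ereal (LINT x|?M. logit (q x) * (\<rho> x - q x))"
    by simp
  moreover have "AE x in ?M. 0 \<le> q x \<and> q x \<le> 1"
    using q01 by eventually_elim auto
  ultimately show ?thesis
    using \<rho>01 by (simp add: fermi_dirac_def)
qed

lemma L2_body_force:
  fixes g :: "real^'d::finite \<Rightarrow> real^'d"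
  assumes g: "g \<in> Lp 2 (lebesgue_on \<Omega>)"
  shows "bounded_functional (V \<Omega> \<Gamma>\<^sub>0) (H1v_norm \<Omega>) (\<lambda>v. LINT x|lebesgue_on \<Omega>. g x \<bullet> v x)"
proof -
  let ?M = "lebesgue_on \<Omega>"
  define G where "G = (LINT x|?M. (norm (g x))\<^sup>2)"
  have gm[measurable]: "g \<in> borel_measurable ?M" and gi: "integrable ?M (\<lambda>x. (norm (g x))\<^sup>2)"
    using g by (auto simp: Lp2_iff)
  have G0: "0 \<le> G"
    unfolding G_def by simp
  have vm: "v \<in> borel_measurable ?M" and vi: "integrable ?M (\<lambda>x. (norm (v x))\<^sup>2)"
    and vn: "(LINT x|?M. (norm (v x))\<^sup>2) \<le> (H1v_norm \<Omega> v)\<^sup>2" if "v \<in> V \<Omega> \<Gamma>\<^sub>0" for v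
  proof -
    have c: "(\<lambda>x. v x $ i) \<in> borel_measurable ?M" "integrable ?M (\<lambda>x. (v x $ i)\<^sup>2)" for i
      using that by (auto simp: V_def H1v_def H1_def Lp2_iff)
    show "v \<in> borel_measurable ?M"
      using c(1) by (subst borel_measurable_euclidean_space) (auto simp: Basis_vec_def inner_axis)
    have n: "(norm (v x))\<^sup>2 = (\<Sum>i\<in>UNIV. (v x $ i)\<^sup>2)" for x
      by (simp add: norm_vec_def L2_set_def sum_nonneg)
    show "integrable ?M (\<lambda>x. (norm (v x))\<^sup>2)"
      unfolding n using c by auto
    have "(LINT x|?M. (norm (v x))\<^sup>2) = (\<Sum>i\<in>UNIV. LINT x|?M. (v x $ i)\<^sup>2)"
      unfolding n using c by auto
    also have "\<dots> \<le> (\<Sum>i\<in>UNIV. (H1_norm \<Omega> (\<lambda>x. v x $ i))\<^sup>2)"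
      by (intro sum_mono) (simp add: H1_norm_def)
    also have "\<dots> = (H1v_norm \<Omega> v)\<^sup>2"
      by (simp add: H1v_norm_def sum_nonneg)
    finally show "(LINT x|?M. (norm (v x))\<^sup>2) \<le> (H1v_norm \<Omega> v)\<^sup>2" .
  qed
  have young: "\<bar>a \<bullet> b\<bar> \<le> t * (norm a)\<^sup>2 / 2 + (norm b)\<^sup>2 / (2 * t)" if "0 < t" for a b :: "real^'d" and t :: real
  proof -
    have "0 \<le> (t * norm a - norm b)\<^sup>2 / (2 * t)"
      using that by simp
    also have "\<dots> = t * (norm a)\<^sup>2 / 2 + (norm b)\<^sup>2 / (2 * t) - norm a * norm b"
      using that by (simp add: power2_eq_square field_simps)
    finally show ?thesis
      using Cauchy_Schwarz_ineq2[of a b] by linarith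
  qed
  have gv: "integrable ?M (\<lambda>x. g x \<bullet> v x)" if "v \<in> V \<Omega> \<Gamma>\<^sub>0" for v
  proof (rule Bochner_Integration.integrable_bound)
    show "integrable ?M (\<lambda>x. 1 * (norm (g x))\<^sup>2 / 2 + (norm (v x))\<^sup>2 / (2 * 1))"
      using gi vi[OF that] by simp
    show "(\<lambda>x. g x \<bullet> v x) \<in> borel_measurable ?M"
      using vm[OF that] by simp
    show "AE x in ?M. norm (g x \<bullet> v x) \<le> norm (1 * (norm (g x))\<^sup>2 / 2 + (norm (v x))\<^sup>2 / (2 * 1))"
      using young[of 1] by (intro AE_I2) (smt (verit) real_norm_def)
  qed
  have bound: "\<bar>LINT x|?M. g x \<bullet> v x\<bar> \<le> sqrt G * H1v_norm \<Omega> v" if v: "v \<in> V \<Omega> \<Gamma>\<^sub>0" for v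
  proof -
    define W where "W = (LINT x|?M. (norm (v x))\<^sup>2)"
    have W0: "0 \<le> W"
      unfolding W_def by simp
    have N0: "0 \<le> H1v_norm \<Omega> v"
      unfolding H1v_norm_def by (simp add: sum_nonneg)
    have W: "sqrt W \<le> H1v_norm \<Omega> v"
      using vn[OF v] N0 real_le_lsqrt unfolding W_def by blast
    have est: "\<bar>LINT x|?M. g x \<bullet> v x\<bar> \<le> t * G / 2 + W / (2 * t)" if "0 < t" for t
    proof -
      have "\<bar>LINT x|?M. g x \<bullet> v x\<bar> \<le> (LINT x|?M. t * (norm (g x))\<^sup>2 / 2 + (norm (v x))\<^sup>2 / (2 * t))"
        using gi vi[OF v] gv[OF v] young[OF that]
        by (intro order.trans[OF integral_abs_bound] integral_mono) auto
      also have "\<dots> = t * G / 2 + W / (2 * t)"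
        using gi vi[OF v] by (simp add: G_def W_def)
      finally show ?thesis .
    qed
    have "\<bar>LINT x|?M. g x \<bullet> v x\<bar> \<le> sqrt G * sqrt W"
    proof (rule field_le_epsilon)
      fix e :: real
      assume e: "0 < e"
      show "\<bar>LINT x|?M. g x \<bullet> v x\<bar> \<le> sqrt G * sqrt W + e"
      proof (cases "G = 0")
        case True
        have "\<bar>LINT x|?M. g x \<bullet> v x\<bar> \<le> W / (2 * ((W + 1) / e))"
          using est[of "(W + 1) / e"] True W0 e by simp
        also have "\<dots> \<le> e"
          using W0 e by (simp add: field_simps)
        finally show ?thesis using True by simp
      next
        case False
        show ?thesis
        proof (cases "W = 0")
          case True
          have "\<bar>LINT x|?M. g x \<bullet> v x\<bar> \<le> e / G * G / 2 + W / (2 * (e / G))"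
            using G0 False e by (intro est) simp
          then show ?thesis
            using True False e by simp
        next
          case W1: False
          have GW: "0 < sqrt G" "0 < sqrt W"
            using G0 W0 False W1 by auto
          have "\<bar>LINT x|?M. g x \<bullet> v x\<bar> \<le> sqrt W / sqrt G * G / 2 + W / (2 * (sqrt W / sqrt G))"
            using GW by (intro est) simp
          also have "\<dots> = sqrt W / sqrt G * (sqrt G * sqrt G) / 2 + (sqrt W * sqrt W) / (2 * (sqrt W / sqrt G))"
            using G0 W0 by simp
          also have "\<dots> = sqrt G * sqrt W"
            using GW by (simp add: field_simps del: real_sqrt_mult_self)
          finally show ?thesis using e by simp
        qed
      qed
    qed
    also have "\<dots> \<le> sqrt G * H1v_norm \<Omega> v"
      using W G0 by (intro mult_left_mono) auto
    finally show ?thesis .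
  qed
  show ?thesis
    unfolding bounded_functional_def
  proof (intro conjI ballI allI exI)
    fix v w :: "real^'d \<Rightarrow> real^'d" and a b :: real
    assume "v \<in> V \<Omega> \<Gamma>\<^sub>0" "w \<in> V \<Omega> \<Gamma>\<^sub>0"
    then show "(LINT x|?M. g x \<bullet> (a *\<^sub>R v x + b *\<^sub>R w x)) = a * (LINT x|?M. g x \<bullet> v x) + b * (LINT x|?M. g x \<bullet> w x)"
      using gv by (simp add: inner_add_right)
  qed (rule bound)
qed

end

theory Submission
  imports Defs
begin

text \<open>The candidate minimizer is \<open>\<rho> = \<sigma>(\<sigma>\<inverse>(\<rho>\<^sub>k) - \<alpha> \<nabla>F(\<rho>\<^sub>k) - \<mu>)\<close>. A multiplier \<open>\<mu>\<close> giving \<open>\<rho>\<close> the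
  right volume exists by the intermediate value theorem: for \<open>\<mu> = \<plusminus>\<alpha>B\<close> with \<open>\<bar>\<nabla>F(\<rho>\<^sub>k)\<bar> \<le> B\<close> the
  candidate lies below, respectively above, \<open>\<rho>\<^sub>k\<close>, which has that volume. The three-point identity of the Bregman
  divergence then gives \<open>J(\<eta>) - J(\<rho>) = D(\<eta>, \<rho>) / \<alpha>\<close> for every admissible \<open>\<eta>\<close>, the term
  \<open>\<mu> \<integral>(\<eta> - \<rho>)\<close> being zero by the volume constraint, and \<open>D(\<eta>, \<rho>)\<close> is nonnegative and vanishes only for
  \<open>\<eta> = \<rho>\<close>.\<close>

section \<open>The sigmoid and its inverse\<close>

lemma sigmoid_pos: "0 < sigmoid t"
  by (simp add: sigmoid_def add_pos_pos)

lemma sigmoid_less_1: "sigmoid t < 1"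
  by (simp add: sigmoid_def add_pos_pos)

lemma sigmoid_mono: "s \<le> t \<Longrightarrow> sigmoid s \<le> sigmoid t"
  unfolding sigmoid_def by (intro frac_le) (auto intro: add_pos_pos)

lemma isCont_sigmoid: "isCont sigmoid t"
proof -
  have "1 + exp (- t) \<noteq> 0"
    using exp_gt_zero[of "- t"] by linarith
  then show ?thesis
    unfolding sigmoid_def[abs_def] by (intro continuous_intros)
qed

lemma borel_measurable_sigmoid[measurable]: "sigmoid \<in> borel_measurable borel"
  unfolding sigmoid_def[abs_def] by measurable

lemma borel_measurable_logit[measurable]: "logit \<in> borel_measurable borel"
  unfolding logit_def[abs_def] by measurable

lemma logit_eq_diff: "0 < t \<Longrightarrow> t < 1 \<Longrightarrow> logit t = ln t - ln (1 - t)"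
  by (simp add: logit_def ln_div)

lemma logit_mono: "0 < s \<Longrightarrow> s \<le> t \<Longrightarrow> t < 1 \<Longrightarrow> logit s \<le> logit t"
  by (simp add: logit_eq_diff diff_mono)

lemma logit_sigmoid: "logit (sigmoid t) = t"
proof -
  have "1 + exp (- t) > 0"
    by (simp add: add_pos_pos)
  then have "sigmoid t / (1 - sigmoid t) = exp t"
    by (simp add: sigmoid_def field_simps flip: exp_add)
  then show ?thesis
    by (simp add: logit_def)
qed

lemma sigmoid_logit: "0 < t \<Longrightarrow> t < 1 \<Longrightarrow> sigmoid (logit t) = t"
  by (simp add: sigmoid_def logit_def exp_minus field_simps)

section \<open>The pointwise divergence\<close>

text \<open>This is the Kullback-Leibler divergence of two Bernoulli distributions and the integrand
  of \<open>bregman_fd\<close>. At t = 0 and t = 1 the logarithm of 0 is multiplied by 0, so its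
  default value does not matter.\<close>

definition fd_div :: "real \<Rightarrow> real \<Rightarrow> real" where
  "fd_div t q = t * ln (t / q) + (1 - t) * ln ((1 - t) / (1 - q))"

lemma borel_measurable_fd_div[measurable (raw)]:
  assumes [measurable]: "f \<in> borel_measurable M" "g \<in> borel_measurable M"
  shows "(\<lambda>x. fd_div (f x) (g x)) \<in> borel_measurable M"
  unfolding fd_div_def by measurable

text \<open>This is ln y \<le> y - 1 at y = q / t, multiplied by -t; the inequality is tight only at
  y = 1. The bound t - q is chosen because it cancels against its counterpart for 1 - t and 1 -
  q.\<close>

lemma xlnx_div_ge:
  fixes t q :: real
  assumes "0 \<le> t" "0 < q"
  shows "t - q \<le> t * ln (t / q)"
    and "t * ln (t / q) = t - q \<Longrightarrow> t = q"
proof -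
  consider "t = 0" | "0 < t"
    using assms by linarith
  then have "t - q \<le> t * ln (t / q) \<and> (t * ln (t / q) = t - q \<longrightarrow> t = q)"
  proof cases
    case 2
    have ln: "t * ln (t / q) = - (t * ln (q / t))" and eq: "t - q = - (t * (q / t - 1))"
      using 2 assms by (auto simp: ln_div field_simps)
    have "t * ln (q / t) \<le> t * (q / t - 1)"
      using 2 assms by (intro mult_left_mono ln_le_minus_one) auto
    moreover have "t = q" if "t * ln (q / t) = t * (q / t - 1)"
      using that 2 assms ln_eq_minus_one[of "q / t"] by auto
    ultimately show ?thesis
      unfolding ln eq by (metis neg_equal_iff_equal neg_le_iff_le)
  qed (use assms in auto)
  then show "t - q \<le> t * ln (t / q)" "t * ln (t / q) = t - q \<Longrightarrow> t = q"
    by auto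
qed

lemma fd_div_nonneg: "0 \<le> t \<Longrightarrow> t \<le> 1 \<Longrightarrow> 0 < q \<Longrightarrow> q < 1 \<Longrightarrow> 0 \<le> fd_div t q"
  using xlnx_div_ge(1)[of t q] xlnx_div_ge(1)[of "1 - t" "1 - q"] by (simp add: fd_div_def)

text \<open>The two lower bounds from \<open>xlnx_div_ge\<close> add up to 0, so a zero divergence
  makes both of them tight.\<close>

lemma fd_div_eq_0_imp_eq:
  assumes "0 \<le> t" "t \<le> 1" "0 < q" "q < 1" "fd_div t q = 0"
  shows "t = q"
proof (rule xlnx_div_ge(2))
  show "t * ln (t / q) = t - q"
    using xlnx_div_ge(1)[of t q] xlnx_div_ge(1)[of "1 - t" "1 - q"] assms
    by (simp add: fd_div_def)
qed (use assms in auto)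

lemma fd_div_eq:
  assumes "0 \<le> t" "t \<le> 1" "0 < q" "q < 1"
  shows "fd_div t q = t * ln t + (1 - t) * ln (1 - t) - t * ln q - (1 - t) * ln (1 - q)"
proof -
  have "t * ln (t / q) = t * ln t - t * ln q"
    using assms by (cases "t = 0") (auto simp: ln_div algebra_simps)
  moreover have "(1 - t) * ln ((1 - t) / (1 - q)) = (1 - t) * ln (1 - t) - (1 - t) * ln (1 - q)"
    using assms by (cases "t = 1") (auto simp: ln_div algebra_simps)
  ultimately show ?thesis
    by (simp add: fd_div_def)
qed

text \<open>The entropy part is nonpositive, and the weights t and 1 - t of the nonnegative numbers
  -ln q and -ln (1 - q) are at most 1. The bound is free of t, which later yields integrability for
  any competitor.\<close>

lemma fd_div_le:
  assumes "0 \<le> t" "t \<le> 1" "0 < q" "q < 1"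
  shows "fd_div t q \<le> - ln q - ln (1 - q)"
proof -
  have xlnx: "s * ln s \<le> 0" if "0 \<le> s" "s \<le> 1" for s :: real
    using that by (cases "s = 0") (auto simp: mult_le_0_iff)
  have "t * (- ln q) \<le> 1 * (- ln q)" "(1 - t) * (- ln (1 - q)) \<le> 1 * (- ln (1 - q))"
    using assms by (intro mult_right_mono; simp)+
  then show ?thesis
    using xlnx[of t] xlnx[of "1 - t"] assms unfolding fd_div_eq[OF assms] by linarith
qed

text \<open>\<open>logit\<close> is the derivative of t ln t + (1 - t) ln (1 - t), so this is the
  scalar three-point identity of Bregman divergences.\<close>

lemma fd_div_three_point:
  assumes "0 \<le> t" "t \<le> 1" "0 < r" "r < 1" "0 < q" "q < 1"
  shows "fd_div t q - fd_div r q = fd_div t r + (logit r - logit q) * (t - r)"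
  using assms by (simp add: fd_div_eq logit_eq_diff algebra_simps)

section \<open>Function spaces in terms of a.e. bounds\<close>

text \<open>Reals a and b fit strictly between 0 and the essential infimum, and between the
  essential supremum and 1. Conversely, 0 < a \<le> q \<le> b a.e. also bounds the norm of q, which
  gives membership in \<open>Lp \<infinity>\<close>.\<close>

lemma int_Linf_box_iff:
  fixes q :: "real^'d \<Rightarrow> real"
  shows "q \<in> int_Linf_box \<Omega> \<longleftrightarrow> q \<in> borel_measurable (lebesgue_on \<Omega>) \<and>
    (\<exists>a b. 0 < a \<and> b < 1 \<and> (AE x in lebesgue_on \<Omega>. a \<le> q x \<and> q x \<le> b))"
    (is "?L \<longleftrightarrow> ?R")
proof
  let ?M = "lebesgue_on \<Omega>"
  assume q: ?L
  obtain a where a: "0 < ereal a" "ereal a < essinf ?M (\<lambda>x. ereal (q x))"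
    using q ereal_dense2 unfolding int_Linf_box_def by blast
  obtain b where b: "esssup ?M (\<lambda>x. ereal (q x)) < ereal b" "ereal b < 1"
    using q ereal_dense2 unfolding int_Linf_box_def by blast
  have "AE x in ?M. a \<le> q x \<and> q x \<le> b"
    using esssup_AE[of "\<lambda>x. ereal (q x)" ?M] esssup_AE[of "\<lambda>x. - ereal (q x)" ?M]
  proof eventually_elim
    case (elim x)
    have "ereal (q x) < ereal b"
      using elim(1) b(1) by (rule order.strict_trans1)
    moreover have "essinf ?M (\<lambda>x. ereal (q x)) \<le> ereal (q x)"
      using elim(2) unfolding essinf_def by (metis ereal_minus_le_minus ereal_uminus_uminus)
    with a(2) have "ereal a < ereal (q x)"
      by (rule order.strict_trans2)
    ultimately show ?case by simp
  qed
  then show ?R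
    using a b q by (auto simp: int_Linf_box_def Lp_def)
next
  let ?M = "lebesgue_on \<Omega>"
  assume ?R
  then obtain a b where [measurable]: "q \<in> borel_measurable ?M" and ab: "0 < a" "b < 1"
    and q: "AE x in ?M. a \<le> q x \<and> q x \<le> b"
    by blast
  have "esssup ?M (\<lambda>x. ereal (norm (q x))) \<le> ereal b"
    using q by (intro esssup_I) (measurable, use ab in auto)
  then have 1: "esssup ?M (\<lambda>x. ereal (norm (q x))) < \<infinity>"
    by (rule order.strict_trans1) simp
  have "esssup ?M (\<lambda>x. - ereal (q x)) \<le> - ereal a"
    using q by (intro esssup_I) auto
  then have "- (- ereal a) \<le> essinf ?M (\<lambda>x. ereal (q x))"
    unfolding essinf_def by (simp only: ereal_minus_le_minus)
  then have "ereal a \<le> essinf ?M (\<lambda>x. ereal (q x))"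
    by simp
  moreover have "0 < ereal a"
    using ab by simp
  ultimately have 2: "0 < essinf ?M (\<lambda>x. ereal (q x))"
    by (rule order.strict_trans2[rotated])
  have "esssup ?M (\<lambda>x. ereal (q x)) \<le> ereal b"
    using q by (intro esssup_I) auto
  then have 3: "esssup ?M (\<lambda>x. ereal (q x)) < 1"
    by (rule order.strict_trans1) (use ab in simp)
  show ?L
    using 1 2 3 by (simp add: int_Linf_box_def Lp_def)
qed

lemma Lp_infinity_AE_bound:
  assumes "g \<in> Lp \<infinity> M"
  obtains B where "0 \<le> B" "AE x in M. norm (g x) \<le> B"
proof -
  obtain B where B: "esssup M (\<lambda>x. ereal (norm (g x))) < ereal B"
    using assms ereal_dense2[of _ "\<infinity>"] by (auto simp: Lp_def)
  \<comment> \<open>On a null measure the essential supremum is -\<infinity>, so B itself may be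
    negative.\<close>
  have "AE x in M. norm (g x) \<le> max B 0"
    using esssup_AE[of "\<lambda>x. ereal (norm (g x))" M]
  proof eventually_elim
    case (elim x)
    then have "ereal (norm (g x)) < ereal B"
      using B by (rule order.strict_trans1)
    then show ?case by simp
  qed
  then show thesis
    by (intro that[of "max B 0"]) auto
qed

text \<open>By \<open>admissible_indep\<close> only the exponent \<infinity> has to be considered,
  where the values in [0,1] already imply essential boundedness.\<close>

lemma admissible_iff:
  assumes "bounded \<Omega>" "open \<Omega>" "1 \<le> p"
  shows "\<rho> \<in> admissible p \<theta> \<Omega> \<longleftrightarrow> \<rho> \<in> borel_measurable (lebesgue_on \<Omega>) \<and>
    (AE x in lebesgue_on \<Omega>. 0 \<le> \<rho> x \<and> \<rho> x \<le> 1) \<and>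
    (LINT x|lebesgue_on \<Omega>. \<rho> x) = \<theta> * measure lebesgue \<Omega>"
proof -
  let ?M = "lebesgue_on \<Omega>"
  have "esssup ?M (\<lambda>x. ereal (norm (\<rho> x))) < \<infinity>"
    if [measurable]: "\<rho> \<in> borel_measurable ?M" and "AE x in ?M. 0 \<le> \<rho> x \<and> \<rho> x \<le> 1"
  proof (rule order.strict_trans1)
    show "esssup ?M (\<lambda>x. ereal (norm (\<rho> x))) \<le> 1"
      using that(2) by (intro esssup_I) auto
  qed simp
  moreover have "admissible p \<theta> \<Omega> = admissible \<infinity> \<theta> \<Omega>"
    using assms by (intro admissible_indep) auto
  ultimately show ?thesis
    by (auto simp: admissible_def Lp_vol_def Lp_box_def Lp_def)
qed

lemma admissible_interior_iff:
  fixes \<rho> :: "real^'d \<Rightarrow> real"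
  shows "\<rho> \<in> admissible_interior \<theta> \<Omega> \<longleftrightarrow>
    \<rho> \<in> int_Linf_box \<Omega> \<and> (LINT x|lebesgue_on \<Omega>. \<rho> x) = \<theta> * measure lebesgue \<Omega>"
  by (auto simp: admissible_interior_def Lp_vol_def int_Linf_box_def)

lemma admissible_interior_imp_admissible:
  fixes \<rho> :: "real^'d \<Rightarrow> real"
  assumes "bounded \<Omega>" "open \<Omega>" "1 \<le> p" "\<rho> \<in> admissible_interior \<theta> \<Omega>"
  shows "\<rho> \<in> admissible p \<theta> \<Omega>"
  using assms by (fastforce simp: admissible_iff admissible_interior_iff int_Linf_box_iff)

section \<open>Existence of the multiplier\<close>

text \<open>Here w stands for \<open>logit\<close> of the current iterate and h for the scaled
  gradient. Since h + B \<ge> 0 and h - B \<le> 0 a.e., the target volume lies between the values at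
  \<mu> = B and \<mu> = -B.\<close>

lemma (in finite_measure) volume_correction_exists:
  fixes w h :: "'a \<Rightarrow> real"
  assumes [measurable]: "w \<in> borel_measurable M" "h \<in> borel_measurable M"
    and h: "AE x in M. \<bar>h x\<bar> \<le> B" and "0 \<le> B"
  obtains \<mu> where "(LINT x|M. sigmoid (w x - h x - \<mu>)) = (LINT x|M. sigmoid (w x))"
proof -
  let ?\<Phi> = "\<lambda>\<mu>. LINT x|M. sigmoid (w x - h x - \<mu>)"
  have int: "integrable M (\<lambda>x. sigmoid (f x))" if [measurable]: "f \<in> borel_measurable M" for f
    by (rule integrable_const_bound[where B = 1])
      (auto intro!: AE_I2 less_imp_le sigmoid_less_1 simp: abs_of_pos sigmoid_pos)
  \<comment> \<open>Sequential continuity suffices, and dominated convergence supplies it: the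
    constant 1 dominates the sigmoid and is integrable on a finite measure.\<close>
  have "isCont ?\<Phi> \<mu>" for \<mu>
    unfolding continuous_at_sequentially comp_def
  proof (intro allI impI)
    fix X :: "nat \<Rightarrow> real"
    assume X: "X \<longlonglongrightarrow> \<mu>"
    show "(\<lambda>n. ?\<Phi> (X n)) \<longlonglongrightarrow> ?\<Phi> \<mu>"
    proof (rule integral_dominated_convergence[where w = "\<lambda>_. 1"])
      show "AE x in M. (\<lambda>n. sigmoid (w x - h x - X n)) \<longlonglongrightarrow> sigmoid (w x - h x - \<mu>)"
        using X by (intro AE_I2 isCont_tendsto_compose[OF isCont_sigmoid] tendsto_intros)
    qed (auto intro!: AE_I2 less_imp_le sigmoid_less_1 simp: abs_of_pos sigmoid_pos)
  qed
  moreover have "?\<Phi> B \<le> (LINT x|M. sigmoid (w x))"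
    using h by (intro integral_mono_AE int) (auto intro: sigmoid_mono elim!: eventually_mono)
  moreover have "(LINT x|M. sigmoid (w x)) \<le> ?\<Phi> (- B)"
    using h by (intro integral_mono_AE int) (auto intro: sigmoid_mono elim!: eventually_mono)
  ultimately have "\<exists>\<mu>\<ge>- B. \<mu> \<le> B \<and> ?\<Phi> \<mu> = (LINT x|M. sigmoid (w x))"
    using \<open>0 \<le> B\<close> by (intro IVT2) auto
  then show thesis
    using that by blast
qed

section \<open>The integrated divergence\<close>

text \<open>As q stays a.e. in [a, b] with 0 < a and b < 1, the bound of \<open>fd_div_le\<close>
  becomes a constant.\<close>

lemma integrable_fd_div:
  fixes \<rho> q :: "real^'d \<Rightarrow> real"
  assumes \<Omega>: "bounded \<Omega>" "open \<Omega>"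
    and [measurable]: "\<rho> \<in> borel_measurable (lebesgue_on \<Omega>)"
    and \<rho>: "AE x in lebesgue_on \<Omega>. 0 \<le> \<rho> x \<and> \<rho> x \<le> 1" and q: "q \<in> int_Linf_box \<Omega>"
  shows "integrable (lebesgue_on \<Omega>) (\<lambda>x. fd_div (\<rho> x) (q x))"
proof -
  obtain a b where [measurable]: "q \<in> borel_measurable (lebesgue_on \<Omega>)" and ab: "0 < a" "b < 1"
    and qab: "AE x in lebesgue_on \<Omega>. a \<le> q x \<and> q x \<le> b"
    using q by (auto simp: int_Linf_box_iff)
  show ?thesis
  proof (rule integrable_bounded_lebesgue_on[where B = "- ln a - ln (1 - b)"])
    show "AE x in lebesgue_on \<Omega>. \<bar>fd_div (\<rho> x) (q x)\<bar> \<le> - ln a - ln (1 - b)"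
      using \<rho> qab
    proof eventually_elim
      case (elim x)
      have "ln a \<le> ln (q x)" "ln (1 - b) \<le> ln (1 - q x)"
        using elim ab by auto
      moreover have "0 < q x" "q x < 1"
        using elim ab by auto
      ultimately show ?case
        using elim fd_div_le[of "\<rho> x" "q x"] fd_div_nonneg[of "\<rho> x" "q x"] by linarith
    qed
  qed (use \<Omega> in auto)
qed

lemma bregman_fd_eq_integral:
  "bregman_fd \<Omega> \<rho> q = (LINT x|lebesgue_on \<Omega>. fd_div (\<rho> x) (q x))"
  by (simp add: bregman_fd_def fd_div_def)

lemma bregman_fd_nonneg:
  fixes \<rho> q :: "real^'d \<Rightarrow> real"
  assumes "AE x in lebesgue_on \<Omega>. 0 \<le> \<rho> x \<and> \<rho> x \<le> 1" and "q \<in> int_Linf_box \<Omega>"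
  shows "0 \<le> bregman_fd \<Omega> \<rho> q"
proof -
  obtain a b where "0 < a" "b < 1" "AE x in lebesgue_on \<Omega>. a \<le> q x \<and> q x \<le> b"
    using assms(2) by (auto simp: int_Linf_box_iff)
  then have "AE x in lebesgue_on \<Omega>. 0 \<le> fd_div (\<rho> x) (q x)"
    using assms(1) by (auto intro!: fd_div_nonneg elim!: eventually_elim2)
  then show ?thesis
    unfolding bregman_fd_eq_integral by (rule integral_nonneg_AE)
qed

lemma bregman_fd_eq_0_imp_AE_eq:
  fixes \<rho> q :: "real^'d \<Rightarrow> real"
  assumes \<Omega>: "bounded \<Omega>" "open \<Omega>"
    and \<rho>: "\<rho> \<in> borel_measurable (lebesgue_on \<Omega>)"
      "AE x in lebesgue_on \<Omega>. 0 \<le> \<rho> x \<and> \<rho> x \<le> 1"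
    and q: "q \<in> int_Linf_box \<Omega>" and 0: "bregman_fd \<Omega> \<rho> q = 0"
  shows "AE x in lebesgue_on \<Omega>. \<rho> x = q x"
proof -
  obtain a b where ab: "0 < a" "b < 1" "AE x in lebesgue_on \<Omega>. a \<le> q x \<and> q x \<le> b"
    using q by (auto simp: int_Linf_box_iff)
  have "AE x in lebesgue_on \<Omega>. 0 \<le> fd_div (\<rho> x) (q x)"
    using ab \<rho>(2) by (auto intro!: fd_div_nonneg elim!: eventually_elim2)
  \<comment> \<open>Integrability matters here: the integral of a non-integrable function is 0 by
    default and would say nothing.\<close>
  then have "AE x in lebesgue_on \<Omega>. fd_div (\<rho> x) (q x) = 0"
    using 0 integrable_fd_div[OF \<Omega> \<rho> q] by (simp add: bregman_fd_eq_integral integral_nonneg_eq_0_iff_AE)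
  then show ?thesis
    using ab(3) \<rho>(2) by eventually_elim (use ab in \<open>auto intro: fd_div_eq_0_imp_eq\<close>)
qed

section \<open>Comparison of the objective with a competitor\<close>

text \<open>Here q is the current iterate, \<rho> the update and \<eta> a competitor. The update
  equation replaces the \<open>logit\<close> difference in the three-point identity by -(\<alpha> g
  + \<mu>), so the gradient terms balance and only the divergence from \<eta> to \<rho> is left
  over.\<close>

lemma mirror_objective_diff:
  fixes g \<rho> q \<eta> :: "real^'d \<Rightarrow> real"
  assumes \<Omega>: "bounded \<Omega>" "open \<Omega>" and "\<alpha> > 0"
    and g: "g \<in> Lp \<infinity> (lebesgue_on \<Omega>)"
    and q: "q \<in> int_Linf_box \<Omega>" and \<rho>: "\<rho> \<in> int_Linf_box \<Omega>"
    and \<eta>: "\<eta> \<in> borel_measurable (lebesgue_on \<Omega>)"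
      "AE x in lebesgue_on \<Omega>. 0 \<le> \<eta> x \<and> \<eta> x \<le> 1"
    and vol: "(LINT x|lebesgue_on \<Omega>. \<eta> x) = (LINT x|lebesgue_on \<Omega>. \<rho> x)"
    and upd: "AE x in lebesgue_on \<Omega>. logit (\<rho> x) = logit (q x) - \<alpha> * g x - \<mu>"
  shows "(LINT x|lebesgue_on \<Omega>. g x * \<eta> x) + (1 / \<alpha>) * bregman_fd \<Omega> \<eta> q =
    (LINT x|lebesgue_on \<Omega>. g x * \<rho> x) + (1 / \<alpha>) * bregman_fd \<Omega> \<rho> q + (1 / \<alpha>) * bregman_fd \<Omega> \<eta> \<rho>"
proof -
  let ?M = "lebesgue_on \<Omega>"
  obtain B where gB: "0 \<le> B" "AE x in ?M. \<bar>g x\<bar> \<le> B"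
    using Lp_infinity_AE_bound[OF g] by auto
  obtain a b where ab: "0 < a" "b < 1" "AE x in ?M. a \<le> q x \<and> q x \<le> b"
    using q by (auto simp: int_Linf_box_iff)
  obtain c d where cd: "0 < c" "d < 1" "AE x in ?M. c \<le> \<rho> x \<and> \<rho> x \<le> d"
    using \<rho> by (auto simp: int_Linf_box_iff)
  have [measurable]: "g \<in> borel_measurable ?M" "q \<in> borel_measurable ?M" "\<rho> \<in> borel_measurable ?M"
      "\<eta> \<in> borel_measurable ?M"
    using g q \<rho> \<eta> by (auto simp: Lp_def int_Linf_box_def)
  have \<rho>01: "AE x in ?M. 0 \<le> \<rho> x \<and> \<rho> x \<le> 1"
    using cd(3) by eventually_elim (use cd in auto)
  have lin: "integrable ?M \<sigma>" "integrable ?M (\<lambda>x. g x * \<sigma> x)"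
    if [measurable]: "\<sigma> \<in> borel_measurable ?M" and \<sigma>: "AE x in ?M. 0 \<le> \<sigma> x \<and> \<sigma> x \<le> 1" for \<sigma>
  proof -
    show "integrable ?M \<sigma>"
      using \<Omega> by (intro integrable_bounded_lebesgue_on[where B = 1])
        (auto intro: eventually_mono[OF \<sigma>])
    have "AE x in ?M. \<bar>g x * \<sigma> x\<bar> \<le> B"
      using gB(2) \<sigma>
    proof eventually_elim
      case (elim x)
      then have "\<bar>g x\<bar> * \<bar>\<sigma> x\<bar> \<le> B * 1"
        using gB by (intro mult_mono) auto
      then show ?case by (simp add: abs_mult)
    qed
    then show "integrable ?M (\<lambda>x. g x * \<sigma> x)"
      using \<Omega> by (intro integrable_bounded_lebesgue_on) auto
  qed
  have \<rho>m: "\<rho> \<in> borel_measurable ?M"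
    by measurable
  note int = lin[OF \<eta>] lin[OF \<rho>m \<rho>01] integrable_fd_div[OF \<Omega> \<eta> q]
    integrable_fd_div[OF \<Omega> \<rho>m \<rho>01 q] integrable_fd_div[OF \<Omega> \<eta> \<rho>]
  \<comment> \<open>The objective is scaled by \<alpha>. The \<mu> terms stay on both sides, as they
    differ pointwise and cancel only after integration, through \<open>vol\<close>.\<close>
  have "AE x in ?M. \<alpha> * (g x * \<eta> x) + fd_div (\<eta> x) (q x) + \<mu> * \<eta> x =
      \<alpha> * (g x * \<rho> x) + fd_div (\<rho> x) (q x) + fd_div (\<eta> x) (\<rho> x) + \<mu> * \<rho> x"
    using upd ab(3) cd(3) \<eta>(2)
  proof eventually_elim
    case (elim x)
    have "fd_div (\<eta> x) (q x) - fd_div (\<rho> x) (q x) =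
        fd_div (\<eta> x) (\<rho> x) + (logit (\<rho> x) - logit (q x)) * (\<eta> x - \<rho> x)"
      using elim ab cd by (intro fd_div_three_point) auto
    then show ?case
      unfolding elim(1) by (simp add: algebra_simps)
  qed
  then have "(LINT x|?M. \<alpha> * (g x * \<eta> x) + fd_div (\<eta> x) (q x) + \<mu> * \<eta> x) =
      (LINT x|?M. \<alpha> * (g x * \<rho> x) + fd_div (\<rho> x) (q x) + fd_div (\<eta> x) (\<rho> x) + \<mu> * \<rho> x)"
    by (intro integral_cong_AE) measurable
  moreover have "(LINT x|?M. \<alpha> * (g x * \<eta> x) + fd_div (\<eta> x) (q x) + \<mu> * \<eta> x) =
      \<alpha> * (LINT x|?M. g x * \<eta> x) + bregman_fd \<Omega> \<eta> q + \<mu> * (LINT x|?M. \<eta> x)"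
    unfolding bregman_fd_eq_integral
    by (intro has_bochner_integral_integral_eq has_bochner_integral_add has_bochner_integral_mult_right
        has_bochner_integral_integrable int)
  moreover have "(LINT x|?M. \<alpha> * (g x * \<rho> x) + fd_div (\<rho> x) (q x) + fd_div (\<eta> x) (\<rho> x) + \<mu> * \<rho> x) =
      \<alpha> * (LINT x|?M. g x * \<rho> x) + bregman_fd \<Omega> \<rho> q + bregman_fd \<Omega> \<eta> \<rho> + \<mu> * (LINT x|?M. \<rho> x)"
    unfolding bregman_fd_eq_integral
    by (intro has_bochner_integral_integral_eq has_bochner_integral_add has_bochner_integral_mult_right
        has_bochner_integral_integrable int)
  ultimately have eq: "\<alpha> * (LINT x|?M. g x * \<eta> x) + bregman_fd \<Omega> \<eta> q =
      \<alpha> * (LINT x|?M. g x * \<rho> x) + bregman_fd \<Omega> \<rho> q + bregman_fd \<Omega> \<eta> \<rho>"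
    unfolding vol by linarith
  \<comment> \<open>The division by \<alpha> is done for arbitrary reals, so that the integrals are
    treated as atoms.\<close>
  have "a + (1 / \<alpha>) * u = b + (1 / \<alpha>) * v + (1 / \<alpha>) * w" if "\<alpha> * a + u = \<alpha> * b + v + w"
    for a b u v w
    using that \<open>\<alpha> > 0\<close> by (simp add: field_simps)
  from this[OF eq] show ?thesis .
qed

section \<open>Existence, uniqueness and the update formula\<close>

theorem theorem3p4:
  fixes \<Omega> \<Gamma>\<^sub>0 :: "(real^'d::finite) set"
    and \<theta> \<epsilon> \<rho>min s \<alpha> :: real
    and p :: ennreal
    and C :: "real^'d^'d \<Rightarrow> real^'d^'d"
    and f :: "(real^'d \<Rightarrow> real^'d) \<Rightarrow> real"
    and Fhat :: "(real^'d \<Rightarrow> real) \<Rightarrow> (real^'d \<Rightarrow> real^'d) \<Rightarrow> real"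
    and gradF :: "(real^'d \<Rightarrow> real) \<Rightarrow> (real^'d \<Rightarrow> real)"
    and \<rho>\<^sub>k :: "real^'d \<Rightarrow> real"
  defines "F \<equiv> reduced_objective \<Omega> \<Gamma>\<^sub>0 \<epsilon> C f (simp_law \<rho>min s) Fhat"
    and "J \<equiv> (\<lambda>\<rho>. (LINT x|lebesgue_on \<Omega>. gradF \<rho>\<^sub>k x * \<rho> x) + (1 / \<alpha>) * bregman_fd \<Omega> \<rho> \<rho>\<^sub>k)"
  assumes "CARD('d) = 2 \<or> CARD('d) = 3"
    and "open \<Omega>" and "connected \<Omega>" and "bounded \<Omega>" and "\<Omega> \<noteq> {}" and "lipschitz_boundary \<Omega>"
    and "0 \<le> \<theta>" and "\<theta> \<le> 1" and "1 \<le> p"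
    and "\<Gamma>\<^sub>0 \<subseteq> frontier \<Omega>" and "hausdorff_outer (CARD('d) - 1) \<Gamma>\<^sub>0 > 0"
    and "\<epsilon> > 0" and "0 < \<rho>min" and "\<rho>min < 1" and "s > 1"
    and "elasticity_tensor C"
    and "bounded_functional (V \<Omega> \<Gamma>\<^sub>0) (H1v_norm \<Omega>) f"
    and "\<forall>w\<in>H1_pair \<Omega>. \<exists>L. has_frechet_derivative_on (H1_pair \<Omega>) (H1_pair_norm \<Omega>) (H1_pair \<Omega>)
           (\<lambda>w. Fhat (fst \<circ> w) (snd \<circ> w)) w L"
    and "\<forall>\<rho>\<in>admissible p \<theta> \<Omega>. gradF \<rho> \<in> Lp \<infinity> (lebesgue_on \<Omega>) \<and>
           has_frechet_derivative_on (Lp \<infinity> (lebesgue_on \<Omega>)) (Linf_norm (lebesgue_on \<Omega>)) (Lp_box \<infinity> \<Omega>)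
             F \<rho> (\<lambda>q. LINT x|lebesgue_on \<Omega>. gradF \<rho> x * q x)"
    and "\<rho>\<^sub>k \<in> admissible_interior \<theta> \<Omega>"
    and "\<alpha> > 0"
  shows "\<exists>\<rho>. is_arg_min J (\<lambda>\<rho>. \<rho> \<in> admissible p \<theta> \<Omega>) \<rho> \<and>
     (\<forall>\<eta>. is_arg_min J (\<lambda>\<rho>. \<rho> \<in> admissible p \<theta> \<Omega>) \<eta> \<longrightarrow> (AE x in lebesgue_on \<Omega>. \<eta> x = \<rho> x)) \<and>
     \<rho> \<in> admissible_interior \<theta> \<Omega> \<and>
     (\<exists>\<mu>::real.
        (AE x in lebesgue_on \<Omega>. logit (\<rho> x) = logit (\<rho>\<^sub>k x) - \<alpha> * gradF \<rho>\<^sub>k x - \<mu>) \<and>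
        (LINT x|lebesgue_on \<Omega>. sigmoid (logit (\<rho>\<^sub>k x) - \<alpha> * gradF \<rho>\<^sub>k x - \<mu>)) = \<theta> * measure lebesgue \<Omega>)"
proof -
  note \<Omega> = \<open>bounded \<Omega>\<close> \<open>open \<Omega>\<close>
  let ?M = "lebesgue_on \<Omega>"
  let ?P = "\<lambda>\<rho>. \<rho> \<in> admissible p \<theta> \<Omega>"
  let ?g = "gradF \<rho>\<^sub>k"
  have \<rho>k: "\<rho>\<^sub>k \<in> int_Linf_box \<Omega>" "(LINT x|?M. \<rho>\<^sub>k x) = \<theta> * measure lebesgue \<Omega>"
    using \<open>\<rho>\<^sub>k \<in> admissible_interior \<theta> \<Omega>\<close> by (auto simp: admissible_interior_iff)
  \<comment> \<open>The hypothesis on \<open>gradF\<close> ranges over admissible densities, so the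
    interior point has to be recognized as one before its gradient is known to be essentially
    bounded.\<close>
  have "?P \<rho>\<^sub>k"
    using \<Omega> \<open>1 \<le> p\<close> \<open>\<rho>\<^sub>k \<in> admissible_interior \<theta> \<Omega>\<close> by (rule admissible_interior_imp_admissible)
  then have g: "?g \<in> Lp \<infinity> ?M"
    using assms by blast
  obtain B where B: "0 \<le> B" "AE x in ?M. \<bar>?g x\<bar> \<le> B"
    using Lp_infinity_AE_bound[OF g] by auto
  obtain a b where ab: "0 < a" "b < 1" "AE x in ?M. a \<le> \<rho>\<^sub>k x \<and> \<rho>\<^sub>k x \<le> b"
    using \<rho>k by (auto simp: int_Linf_box_iff)
  have [measurable]: "?g \<in> borel_measurable ?M" "\<rho>\<^sub>k \<in> borel_measurable ?M"
    using g \<rho>k by (auto simp: Lp_def int_Linf_box_def)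
  have "\<Omega> \<in> lmeasurable"
    using \<Omega> by (intro bounded_set_imp_lmeasurable) auto
  then interpret finite_measure ?M
    by (rule finite_measure_lebesgue_on)
  have \<alpha>g: "AE x in ?M. \<bar>\<alpha> * ?g x\<bar> \<le> \<alpha> * B"
    using B(2) by eventually_elim (use \<open>\<alpha> > 0\<close> in \<open>simp add: abs_mult\<close>)
  have meas: "(\<lambda>x. logit (\<rho>\<^sub>k x)) \<in> borel_measurable ?M" "(\<lambda>x. \<alpha> * ?g x) \<in> borel_measurable ?M"
    by measurable
  have "0 \<le> \<alpha> * B"
    using B \<open>\<alpha> > 0\<close> by simp
  then obtain \<mu> where \<mu>: "(LINT x|?M. sigmoid (logit (\<rho>\<^sub>k x) - \<alpha> * ?g x - \<mu>)) =
      (LINT x|?M. sigmoid (logit (\<rho>\<^sub>k x)))"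
    by (rule volume_correction_exists[OF meas \<alpha>g])
  \<comment> \<open>The multiplier was found for the volume of
    \<open>sigmoid (logit (\<rho>\<^sub>k x))\<close>. This is the volume of the iterate, whose
    values lie a.e. in the open interval where \<open>logit\<close> is inverted.\<close>
  have "AE x in ?M. sigmoid (logit (\<rho>\<^sub>k x)) = \<rho>\<^sub>k x"
    using ab(3) by eventually_elim (use ab in \<open>auto intro: sigmoid_logit\<close>)
  then have "(LINT x|?M. sigmoid (logit (\<rho>\<^sub>k x))) = (LINT x|?M. \<rho>\<^sub>k x)"
    by (intro integral_cong_AE) measurable
  with \<mu> \<rho>k have vol: "(LINT x|?M. sigmoid (logit (\<rho>\<^sub>k x) - \<alpha> * ?g x - \<mu>)) = \<theta> * measure lebesgue \<Omega>"
    by simp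
  define \<rho> where "\<rho> = (\<lambda>x. sigmoid (logit (\<rho>\<^sub>k x) - \<alpha> * ?g x - \<mu>))"
  have [measurable]: "\<rho> \<in> borel_measurable ?M"
    unfolding \<rho>_def by measurable
  \<comment> \<open>The argument of the sigmoid is essentially bounded, and the sigmoid maps both
    bounds strictly inside (0,1); this puts the candidate in the interior.\<close>
  have "AE x in ?M. sigmoid (logit a - \<alpha> * B - \<mu>) \<le> \<rho> x \<and> \<rho> x \<le> sigmoid (logit b + \<alpha> * B - \<mu>)"
    using ab(3) \<alpha>g
  proof eventually_elim
    case (elim x)
    have "logit a \<le> logit (\<rho>\<^sub>k x)" "logit (\<rho>\<^sub>k x) \<le> logit b"
      using elim ab by (auto intro: logit_mono)
    then show ?case
      using elim unfolding \<rho>_def by (auto intro!: sigmoid_mono)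
  qed
  then have \<rho>_int: "\<rho> \<in> int_Linf_box \<Omega>"
    unfolding int_Linf_box_iff using sigmoid_pos sigmoid_less_1 by auto
  then have \<rho>_adm: "\<rho> \<in> admissible_interior \<theta> \<Omega>"
    using vol by (simp add: admissible_interior_iff \<rho>_def)
  have upd: "AE x in ?M. logit (\<rho> x) = logit (\<rho>\<^sub>k x) - \<alpha> * ?g x - \<mu>"
    by (simp add: \<rho>_def logit_sigmoid)
  have P: "?P \<rho>"
    using \<Omega> \<open>1 \<le> p\<close> \<rho>_adm by (rule admissible_interior_imp_admissible)
  have \<eta>: "\<eta> \<in> borel_measurable ?M" "AE x in ?M. 0 \<le> \<eta> x \<and> \<eta> x \<le> 1"
    "(LINT x|?M. \<eta> x) = (LINT x|?M. \<rho> x)" if "?P \<eta>" for \<eta>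
    using that vol \<Omega> \<open>1 \<le> p\<close> by (auto simp: admissible_iff \<rho>_def)
  have J: "J \<eta> = J \<rho> + (1 / \<alpha>) * bregman_fd \<Omega> \<eta> \<rho>" if "?P \<eta>" for \<eta>
    unfolding J_def using \<Omega> \<open>\<alpha> > 0\<close> g \<rho>k(1) \<rho>_int \<eta>[OF that] upd by (rule mirror_objective_diff)
  have "is_arg_min J ?P \<rho>"
    unfolding is_arg_min_def
  proof (intro conjI P notI, elim exE conjE)
    fix \<eta> assume "?P \<eta>" "J \<eta> < J \<rho>"
    have "0 \<le> (1 / \<alpha>) * bregman_fd \<Omega> \<eta> \<rho>"
      using bregman_fd_nonneg[OF \<eta>(2)[OF \<open>?P \<eta>\<close>] \<rho>_int] \<open>\<alpha> > 0\<close> by simp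
    then show False
      using J[OF \<open>?P \<eta>\<close>] \<open>J \<eta> < J \<rho>\<close> by linarith
  qed
  moreover have "AE x in ?M. \<eta> x = \<rho> x" if "is_arg_min J ?P \<eta>" for \<eta>
  proof -
    \<comment> \<open>A second minimizer does not exceed the candidate in value, so its excess, a
      nonnegative multiple of the divergence, must vanish.\<close>
    have "?P \<eta>" and "J \<eta> \<le> J \<rho>"
      using that P by (auto simp: is_arg_min_def not_less)
    then have "bregman_fd \<Omega> \<eta> \<rho> \<le> 0"
      using J[OF \<open>?P \<eta>\<close>] \<open>\<alpha> > 0\<close> by (simp add: divide_le_0_iff)
    then have "bregman_fd \<Omega> \<eta> \<rho> = 0"
      using bregman_fd_nonneg[OF \<eta>(2)[OF \<open>?P \<eta>\<close>] \<rho>_int] by simp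
    then show ?thesis
      using \<Omega> \<eta>[OF \<open>?P \<eta>\<close>] \<rho>_int by (intro bregman_fd_eq_0_imp_AE_eq)
  qed
  ultimately show ?thesis
    using \<rho>_adm upd vol by blast
qed

end
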